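(* Every diffeological vector space is isomorphic in $\mathrm{DVect}$ to a quotient vector space of a free diffeological vector space; that is, for every diffeological vector space $V$ there exist a diffeological space $X$ and a linear subspace $K\subseteq F(X)$ such that $V$ is isomorphic to $F(X)/K$ in $\mathrm{DVect}$.
   Context: A diffeological space is a set $X$ together with a specified set of functions $U\to X$ (called plots), for every open set $U\subseteq\mathbb{R}^n$ and every $n\in\mathbb{N}=\{0,1,2,\dots\}$, such that: (1) every constant map $U\to X$ is a plot; (2) if $U\to X$ is a plot and $V\to U$ is a smooth map between open subsets of Euclidean spaces, then $V\to U\to X$ is a plot; (3) if $U=\bigcup_i U_i$ is an open cover and $U\to X$ is a map whose restrictions to all $U_i$ are plots, then $U\to X$ is a plot. A map between diffeological spaces is smooth if composing with it sends plots to plots. Products carry the product diffeology (a map into a product is a plot iff all its components are plots), and $\mathbb{R}$ carries the standard diffeology. A diffeological vector space is a real vector space $V$ with a diffeology such that addition $V\times V\to V$ and scalar multiplication $\mathbb{R}\times V\to V$ are smooth. $\mathrm{DVect}$ is the category of diffeological vector spaces and smooth linear maps; an isomorphism in $\mathrm{DVect}$ is a smooth linear bijection with smooth inverse. For a diffeological space $X$, the free diffeological vector space $F(X)$ generated by $X$ is the free real vector space on the underlying set of $X$ (basis elements written $[x]$), with the diffeology generated by all maps $\mathbb{R}\times U_1\times\cdots\times\mathbb{R}\times U_n\to F(X)$, $(r_1,u_1,\dots,r_n,u_n)\mapsto r_1[p_1(u_1)]+\cdots+r_n[p_n(u_n)]$, for all $n\ge 1$ and all plots $p_i:U_i\to X$;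 it is the smallest diffeology making $F(X)$ a diffeological vector space and $X\to F(X)$, $x\mapsto[x]$, smooth. A quotient $W/K$ of a diffeological vector space by a linear subspace carries the quotient diffeology: a map $U\to W/K$ is a plot iff locally on $U$ it lifts to a plot of $W$. *)

theory Defs
  imports
    "HOL-Analysis.Analysis"
    "HOL-Library.Poly_Mapping"
    "HOL-Algebra.Module"
    "HOL-Algebra.AbelCoset"
begin

text \<open>
  \<open>\<real>\<^sup>n\<close> is the library's \<^const>\<open>Euclidean_space\<close>, whose points are the functions
  \<open>x :: nat \<Rightarrow> real\<close> with \<open>x i = 0\<close> for all \<open>i \<ge> n\<close>; this lets \<open>n\<close> range over all
  natural numbers, including \<open>0\<close>, inside one definition.
\<close>

abbreviation open_in_Rn :: "nat \<Rightarrow> (nat \<Rightarrow> real) set \<Rightarrow> bool" where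
  "open_in_Rn n U \<equiv> openin (Euclidean_space n) U"

text \<open>
  \<open>C_k k n U f\<close>: all iterated partial derivatives of \<open>f\<close> of order at most \<open>k\<close> exist and are
  continuous on the open set \<open>U \<subseteq> \<real>\<^sup>n\<close>.  The values of \<open>f\<close> outside \<open>U\<close> are irrelevant.
\<close>

primrec C_k :: "nat \<Rightarrow> nat \<Rightarrow> (nat \<Rightarrow> real) set \<Rightarrow> ((nat \<Rightarrow> real) \<Rightarrow> real) \<Rightarrow> bool" where
  "C_k 0 n U f \<longleftrightarrow> continuous_map (subtopology (Euclidean_space n) U) euclideanreal f"
| "C_k (Suc k) n U f \<longleftrightarrow>
     continuous_map (subtopology (Euclidean_space n) U) euclideanreal f \<and>
     (\<forall>i<n. \<exists>g. (\<forall>x\<in>U. ((\<lambda>t. f (x(i := t))) has_real_derivative g x) (at (x i))) \<and>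
                C_k k n U g)"

definition smooth_fun :: "nat \<Rightarrow> (nat \<Rightarrow> real) set \<Rightarrow> ((nat \<Rightarrow> real) \<Rightarrow> real) \<Rightarrow> bool" where
  "smooth_fun n U f \<longleftrightarrow> (\<forall>k. C_k k n U f)"

definition smooth_between ::
  "nat \<Rightarrow> (nat \<Rightarrow> real) set \<Rightarrow> nat \<Rightarrow> (nat \<Rightarrow> real) set \<Rightarrow> ((nat \<Rightarrow> real) \<Rightarrow> (nat \<Rightarrow> real)) \<Rightarrow> bool"
where
  "smooth_between m V n U h \<longleftrightarrow> h \<in> V \<rightarrow> U \<and> (\<forall>i<n. smooth_fun m V (\<lambda>x. h x i))"


text \<open>
  \<open>D n U\<close> is the set of plots \<open>U \<rightarrow> X\<close> for \<open>U\<close> open in \<open>\<real>\<^sup>n\<close>; what \<open>D n U\<close> is for other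
  \<open>U\<close> never matters.  Plots are extensional functions (\<^const>\<open>undefined\<close> off their domain), so
  that equality of plots is equality of maps on \<open>U\<close>.
\<close>

type_synonym 'a plot_family = "nat \<Rightarrow> (nat \<Rightarrow> real) set \<Rightarrow> ((nat \<Rightarrow> real) \<Rightarrow> 'a) set"

definition diffeology :: "'a set \<Rightarrow> 'a plot_family \<Rightarrow> bool" where
  "diffeology X D \<longleftrightarrow>
     (\<forall>n U. open_in_Rn n U \<longrightarrow> D n U \<subseteq> U \<rightarrow>\<^sub>E X) \<and>
     (\<forall>n U x. open_in_Rn n U \<longrightarrow> x \<in> X \<longrightarrow> (\<lambda>u\<in>U. x) \<in> D n U) \<and>
     (\<forall>n U m V p h. open_in_Rn n U \<longrightarrow> open_in_Rn m V \<longrightarrow> p \<in> D n U \<longrightarrow>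
        smooth_between m V n U h \<longrightarrow> compose V p h \<in> D m V) \<and>
     (\<forall>n U \<U> p. open_in_Rn n U \<longrightarrow> (\<forall>W\<in>\<U>. open_in_Rn n W) \<longrightarrow> \<Union>\<U> = U \<longrightarrow>
        p \<in> U \<rightarrow>\<^sub>E X \<longrightarrow> (\<forall>W\<in>\<U>. restrict p W \<in> D n W) \<longrightarrow> p \<in> D n U)"

definition smooth_map ::
  "'a set \<Rightarrow> 'a plot_family \<Rightarrow> 'b set \<Rightarrow> 'b plot_family \<Rightarrow> ('a \<Rightarrow> 'b) \<Rightarrow> bool"
where
  "smooth_map X D Y E f \<longleftrightarrow> f \<in> X \<rightarrow> Y \<and>
     (\<forall>n U p. open_in_Rn n U \<longrightarrow> p \<in> D n U \<longrightarrow> compose U f p \<in> E n U)"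

definition prod_plots ::
  "'a set \<Rightarrow> 'a plot_family \<Rightarrow> 'b set \<Rightarrow> 'b plot_family \<Rightarrow> ('a \<times> 'b) plot_family"
where
  "prod_plots X D Y E n U =
     {p \<in> U \<rightarrow>\<^sub>E X \<times> Y. compose U fst p \<in> D n U \<and> compose U snd p \<in> E n U}"

definition std_real_plots :: "real plot_family" where
  "std_real_plots n U = {p \<in> U \<rightarrow>\<^sub>E UNIV. smooth_fun n U p}"

definition generated_plots :: "'a set \<Rightarrow> 'a plot_family \<Rightarrow> 'a plot_family" where
  "generated_plots X G n U =
     {p \<in> U \<rightarrow>\<^sub>E X. \<forall>D. diffeology X D \<longrightarrow>
        (\<forall>m W. open_in_Rn m W \<longrightarrow> G m W \<subseteq> D m W) \<longrightarrow> p \<in> D n U}"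


text \<open>
  Real vector spaces are modules over the field \<open>\<real>\<close> in the sense of \<^locale>\<open>module\<close>.  The
  record fields \<open>mult\<close> and \<open>one\<close>, which modules inherit from rings, carry no information.
\<close>

definition real_ring :: "real ring" where
  "real_ring = \<lparr>carrier = UNIV, mult = (*), one = 1, zero = 0, add = (+)\<rparr>"

record 'a dvs = "(real, 'a) module" +
  plots :: "'a plot_family"

definition diffeological_vector_space :: "'a dvs \<Rightarrow> bool" where
  "diffeological_vector_space V \<longleftrightarrow>
     module real_ring V \<and>
     diffeology (carrier V) (plots V) \<and>
     smooth_map (carrier V \<times> carrier V) (prod_plots (carrier V) (plots V) (carrier V) (plots V))
       (carrier V) (plots V) (\<lambda>(x, y). x \<oplus>\<^bsub>V\<^esub> y) \<and>
     smooth_map (UNIV \<times> carrier V) (prod_plots UNIV std_real_plots (carrier V) (plots V))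
       (carrier V) (plots V) (\<lambda>(r, x). r \<odot>\<^bsub>V\<^esub> x)"

definition dvect_hom :: "'a dvs \<Rightarrow> 'b dvs \<Rightarrow> ('a \<Rightarrow> 'b) set" where
  "dvect_hom V W = {f \<in> hom (add_monoid V) (add_monoid W).
     (\<forall>r. \<forall>x\<in>carrier V. f (r \<odot>\<^bsub>V\<^esub> x) = r \<odot>\<^bsub>W\<^esub> f x) \<and>
     smooth_map (carrier V) (plots V) (carrier W) (plots W) f}"

definition dvect_isomorphic :: "'a dvs \<Rightarrow> 'b dvs \<Rightarrow> bool" where
  "dvect_isomorphic V W \<longleftrightarrow>
     diffeological_vector_space V \<and> diffeological_vector_space W \<and>
     (\<exists>f \<in> dvect_hom V W. bij_betw f (carrier V) (carrier W) \<and>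
        smooth_map (carrier W) (plots W) (carrier V) (plots V) (inv_into (carrier V) f))"


text \<open>
  The product \<open>\<real> \<times> U\<^sub>0 \<times> \<dots> \<times> \<real> \<times> U\<^sub>k\<^sub>-\<^sub>1\<close> with \<open>U\<^sub>i \<subseteq> \<real>\<^bsup>d i\<^esup>\<close> is an open subset of
  \<open>\<real>\<^bsup>offset d k\<^esup>\<close>: in a point \<open>w\<close> of it, \<open>r\<^sub>i\<close> is the coordinate of index \<open>offset d i\<close>, and
  \<open>u\<^sub>i\<close> consists of the \<open>d i\<close> coordinates following it.
\<close>

definition offset :: "(nat \<Rightarrow> nat) \<Rightarrow> nat \<Rightarrow> nat" where
  "offset d i = (\<Sum>j<i. 1 + d j)"

definition scalar_coord :: "(nat \<Rightarrow> nat) \<Rightarrow> nat \<Rightarrow> (nat \<Rightarrow> real) \<Rightarrow> real" where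
  "scalar_coord d i w = w (offset d i)"

definition point_coord :: "(nat \<Rightarrow> nat) \<Rightarrow> nat \<Rightarrow> (nat \<Rightarrow> real) \<Rightarrow> (nat \<Rightarrow> real)" where
  "point_coord d i w = (\<lambda>j. if j < d i then w (offset d i + 1 + j) else 0)"

definition generator_domain ::
  "nat \<Rightarrow> (nat \<Rightarrow> nat) \<Rightarrow> (nat \<Rightarrow> (nat \<Rightarrow> real) set) \<Rightarrow> (nat \<Rightarrow> real) set"
where
  "generator_domain k d U =
     {w \<in> topspace (Euclidean_space (offset d k)). \<forall>i<k. point_coord d i w \<in> U i}"

text \<open>\<open>Poly_Mapping.single x r\<close> is \<open>r[x]\<close>.\<close>

definition free_generators :: "'a plot_family \<Rightarrow> ('a \<Rightarrow>\<^sub>0 real) plot_family" where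
  "free_generators D N W =
     {(\<lambda>w\<in>W. \<Sum>i<k. Poly_Mapping.single (p i (point_coord d i w)) (scalar_coord d i w)) | k d U p.
        1 \<le> k \<and> (\<forall>i<k. open_in_Rn (d i) (U i) \<and> p i \<in> D (d i) (U i)) \<and>
        N = offset d k \<and> W = generator_domain k d U}"

definition free_carrier :: "'a set \<Rightarrow> ('a \<Rightarrow>\<^sub>0 real) set" where
  "free_carrier X = {c. Poly_Mapping.keys c \<subseteq> X}"

definition free_dvs :: "'a set \<Rightarrow> 'a plot_family \<Rightarrow> ('a \<Rightarrow>\<^sub>0 real) dvs" where
  "free_dvs X D =
     \<lparr>carrier = free_carrier X, mult = undefined, one = undefined, zero = 0, add = (+),
      smult = (\<lambda>r. Poly_Mapping.map ((*) r)),
      plots = generated_plots (free_carrier X) (free_generators D)\<rparr>"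


definition quotient_plots :: "'a dvs \<Rightarrow> 'a set \<Rightarrow> 'a set plot_family" where
  "quotient_plots W K n U =
     {q \<in> U \<rightarrow>\<^sub>E a_rcosets\<^bsub>W\<^esub> K. \<forall>u\<in>U. \<exists>U' p. open_in_Rn n U' \<and> u \<in> U' \<and> U' \<subseteq> U \<and>
        p \<in> plots W n U' \<and> (\<forall>v\<in>U'. q v = K +>\<^bsub>W\<^esub> p v)}"

text \<open>The scalar multiple \<open>r \<cdot> (K + x) = K + r x\<close> is written without choosing \<open>x\<close>.\<close>

definition quotient_dvs :: "'a dvs \<Rightarrow> 'a set \<Rightarrow> 'a set dvs" where
  "quotient_dvs W K =
     \<lparr>carrier = a_rcosets\<^bsub>W\<^esub> K, mult = undefined, one = undefined, zero = K,
      add = (\<lambda>A B. A <+>\<^bsub>W\<^esub> B), smult = (\<lambda>r A. \<Union>x\<in>A. K +>\<^bsub>W\<^esub> (r \<odot>\<^bsub>W\<^esub> x)),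
      plots = quotient_plots W K\<rparr>"

end

theory Submission
  imports Defs
begin

text \<open>
  Take \<open>X\<close> to be \<open>V\<close> itself and \<open>K\<close> the kernel of the evaluation map \<open>F(V) \<rightarrow> V\<close>,
  \<open>\<Sum>r\<^sub>i[x\<^sub>i] \<mapsto> \<Sum>r\<^sub>i x\<^sub>i\<close>.  The cosets of \<open>K\<close> are the fibres of evaluation, so \<open>v \<mapsto> K + [v]\<close>
  is a linear bijection \<open>V \<rightarrow> F(V)/K\<close>.  It is smooth because \<open>v \<mapsto> [v]\<close> is, and its inverse is
  smooth because evaluation is: the maps into \<open>F(V)\<close> whose evaluation is a plot of \<open>V\<close> form a
  diffeology containing the generators, since the operations of \<open>V\<close> are smooth.  As the bijection
  matches the plots, the quotient inherits from \<open>V\<close> that it is a diffeological vector space.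
\<close>

section \<open>Smooth functions on open subsets of Euclidean space\<close>

text \<open>Only coordinate \<open>i\<close> moves and the others stay constant. This makes the set
  of \<open>t\<close> with \<open>x(i := t)\<close> in an open \<open>U\<close> open in \<real>, so
  partial derivatives on \<open>U\<close> are local.\<close>

lemma continuous_map_fun_upd_Euclidean_space:
  assumes x: "x \<in> topspace (Euclidean_space n)" and i: "i < n"
  shows "continuous_map euclideanreal (Euclidean_space n) (\<lambda>t. x(i := t))"
proof -
  have "continuous_map euclideanreal euclideanreal (\<lambda>t. (x(i := t)) j)" for j
    by (cases "j = i") simp_all
  then have "continuous_map euclideanreal (Euclidean_space n)
      (\<lambda>t j. if j < n then (x(i := t)) j else 0)"
    unfolding continuous_map_componentwise_Euclidean_space by blast
  also have "(\<lambda>t j. if j < n then (x(i := t)) j else 0) = (\<lambda>t. x(i := t))"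
    using x i by (auto simp: fun_eq_iff topspace_Euclidean_space)
  finally show ?thesis .
qed

text \<open>A partial derivative at a point of \<open>U\<close> sees the function only near that
  point on a coordinate line, which stays in \<open>U\<close>. The derivative functions of
  \<open>f\<close> therefore serve unchanged for \<open>g\<close>, and a case distinction on
  \<open>k\<close> replaces induction. This allows passing between a function and its restriction to
  \<open>U\<close>, as plots are extensional.\<close>

lemma C_k_cong:
  assumes U: "open_in_Rn n U" and C: "C_k k n U f" and eq: "\<And>x. x \<in> U \<Longrightarrow> f x = g x"
  shows "C_k k n U g"
proof -
  have cont: "continuous_map (subtopology (Euclidean_space n) U) euclideanreal g"
    if "continuous_map (subtopology (Euclidean_space n) U) euclideanreal f"
    using that by (rule continuous_map_eq) (simp add: eq)
  have deriv: "((\<lambda>t. g (x(i := t))) has_real_derivative d) (at (x i))"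
    if "((\<lambda>t. f (x(i := t))) has_real_derivative d) (at (x i))" "x \<in> U" "i < n" for x i d
  proof (rule has_field_derivative_transform_within_open[OF that(1)])
    have "x \<in> topspace (Euclidean_space n)"
      using openin_subset[OF U] that(2) by blast
    from openin_continuous_map_preimage[OF continuous_map_fun_upd_Euclidean_space[OF this \<open>i < n\<close>] U]
    show "open {t. x(i := t) \<in> U}" by simp
  qed (use that eq in auto)
  show ?thesis
  proof (cases k)
    case 0
    then show ?thesis using C cont by simp
  next
    case (Suc l)
    have "\<exists>d. (\<forall>x\<in>U. ((\<lambda>t. g (x(i := t))) has_real_derivative d x) (at (x i))) \<and> C_k l n U d"
      if i: "i < n" for i
    proof -
      obtain d where "\<forall>x\<in>U. ((\<lambda>t. f (x(i := t))) has_real_derivative d x) (at (x i))" "C_k l n U d"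
        using C i unfolding Suc C_k.simps by blast
      with deriv i show ?thesis by (intro exI[of _ d]) auto
    qed
    moreover have "continuous_map (subtopology (Euclidean_space n) U) euclideanreal g"
      using C Suc cont by auto
    ultimately show ?thesis using Suc by simp
  qed
qed

lemma smooth_fun_cong:
  assumes "open_in_Rn n U" "smooth_fun n U f" "\<And>x. x \<in> U \<Longrightarrow> f x = g x"
  shows "smooth_fun n U g"
  using assms(2) C_k_cong[OF assms(1) _ assms(3)] by (simp add: smooth_fun_def)

lemma smooth_fun_const: "smooth_fun n U (\<lambda>x. c)"
proof -
  have "C_k k n U (\<lambda>x. c)" for k
  proof (induction k arbitrary: c)
    case (Suc k)
    have "(\<forall>x\<in>U. ((\<lambda>t. c) has_real_derivative 0) (at (x i))) \<and> C_k k n U (\<lambda>x. 0)" for i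
      using Suc by simp
    then show ?case unfolding C_k.simps by (intro conjI allI impI exI[of _ "\<lambda>x. 0"]) simp_all
  qed simp
  then show ?thesis by (simp add: smooth_fun_def)
qed

lemma continuous_map_Euclidean_space_component:
  "continuous_map (Euclidean_space n) euclideanreal (\<lambda>x. x j)"
  unfolding Euclidean_space_def
  by (intro continuous_map_from_subtopology continuous_map_product_projection) simp

text \<open>Each partial derivative is the constant 1 or 0, so smoothness reduces to that of
  constants.\<close>

lemma smooth_fun_component: "smooth_fun n U (\<lambda>x. x j)"
proof -
  have "C_k k n U (\<lambda>x. x j)" for k
  proof (cases k)
    case (Suc l)
    have "((\<lambda>t. (x(i := t)) j) has_real_derivative (if j = i then 1 else 0)) (at (x i))"
      for x :: "nat \<Rightarrow> real" and i
      by (cases "j = i") simp_all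
    moreover have "C_k l n U (\<lambda>x. c)" for c
      using smooth_fun_const by (simp add: smooth_fun_def)
    ultimately have "\<exists>g. (\<forall>x\<in>U. ((\<lambda>t. (x(i := t)) j) has_real_derivative g x) (at (x i))) \<and> C_k l n U g"
      for i
      by (intro exI[of _ "\<lambda>x. if j = i then 1 else 0"] conjI ballI)
    then show ?thesis
      unfolding Suc C_k.simps
      by (intro conjI allI impI continuous_map_from_subtopology
          continuous_map_Euclidean_space_component)
  qed (auto intro: continuous_map_from_subtopology continuous_map_Euclidean_space_component)
  then show ?thesis by (simp add: smooth_fun_def)
qed

text \<open>Both reparametrisations used below, the projections \<open>point_coord\<close> and the
  embedding of \<open>u\<close> as \<open>(1, u)\<close>, have only coordinates of these two
  kinds.\<close>

lemma smooth_between_const_or_component: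
  assumes "h \<in> V \<rightarrow> U" "\<And>i. i < n \<Longrightarrow> (\<exists>c. \<forall>x. h x i = c) \<or> (\<exists>j. \<forall>x. h x i = x j)"
  shows "smooth_between m V n U h"
  unfolding smooth_between_def
proof (intro conjI allI impI)
  fix i assume "i < n"
  from assms(2)[OF this] show "smooth_fun m V (\<lambda>x. h x i)"
    by (auto simp: smooth_fun_const smooth_fun_component)
qed (rule assms(1))

lemma smooth_between_point_coord:
  assumes "\<And>w. w \<in> W \<Longrightarrow> point_coord d i w \<in> U"
  shows "smooth_between N W (d i) U (point_coord d i)"
proof (rule smooth_between_const_or_component)
  show "point_coord d i \<in> W \<rightarrow> U" using assms by auto
  fix j assume "j < d i"
  then have "\<forall>w. point_coord d i w j = w (offset d i + 1 + j)" by (simp add: point_coord_def)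
  then show "(\<exists>c. \<forall>w. point_coord d i w j = c) \<or> (\<exists>l. \<forall>w. point_coord d i w j = w l)" by blast
qed

lemma component_std_real_plot:
  assumes "open_in_Rn n U"
  shows "(\<lambda>u\<in>U. u j) \<in> std_real_plots n U"
  unfolding std_real_plots_def
  using smooth_fun_cong[OF assms smooth_fun_component[of n U j]] by simp

text \<open>The domain of a one-term generator is the preimage of \<open>U 0\<close> under the
  continuous projection \<open>point_coord d 0\<close>.\<close>

lemma openin_generator_domain_one:
  assumes U: "open_in_Rn (d 0) (U 0)"
  shows "open_in_Rn (offset d 1) (generator_domain 1 d U)"
proof -
  have "continuous_map (Euclidean_space (offset d 1)) (Euclidean_space (d 0)) (point_coord d 0)"
    unfolding point_coord_def continuous_map_componentwise_Euclidean_space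
    by (simp add: continuous_map_Euclidean_space_component)
  from openin_continuous_map_preimage[OF this U] show ?thesis
    by (simp add: generator_domain_def)
qed


section \<open>Diffeologies\<close>

lemma diffeologyD:
  assumes "diffeology X D" "open_in_Rn n U"
  shows diffeology_plot_funcset: "p \<in> D n U \<Longrightarrow> p \<in> U \<rightarrow>\<^sub>E X"
    and diffeology_const: "x \<in> X \<Longrightarrow> (\<lambda>u\<in>U. x) \<in> D n U"
    and diffeology_compose: "p \<in> D n U \<Longrightarrow> open_in_Rn m V \<Longrightarrow> smooth_between m V n U h \<Longrightarrow>
      compose V p h \<in> D m V"
    and diffeology_glue: "p \<in> U \<rightarrow>\<^sub>E X \<Longrightarrow> (\<And>W. W \<in> \<U> \<Longrightarrow> open_in_Rn n W) \<Longrightarrow> \<Union>\<U> = U \<Longrightarrow>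
      (\<And>W. W \<in> \<U> \<Longrightarrow> restrict p W \<in> D n W) \<Longrightarrow> p \<in> D n U"
proof -
  note D = assms(1)[unfolded diffeology_def]
  show "p \<in> D n U \<Longrightarrow> p \<in> U \<rightarrow>\<^sub>E X"
    using D[THEN conjunct1] assms(2) by blast
  show "x \<in> X \<Longrightarrow> (\<lambda>u\<in>U. x) \<in> D n U"
    using D[THEN conjunct2, THEN conjunct1] assms(2) by blast
  show "p \<in> D n U \<Longrightarrow> open_in_Rn m V \<Longrightarrow> smooth_between m V n U h \<Longrightarrow> compose V p h \<in> D m V"
    using D[THEN conjunct2, THEN conjunct2, THEN conjunct1] assms(2) by blast
  show "p \<in> U \<rightarrow>\<^sub>E X \<Longrightarrow> (\<And>W. W \<in> \<U> \<Longrightarrow> open_in_Rn n W) \<Longrightarrow> \<Union>\<U> = U \<Longrightarrow>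
      (\<And>W. W \<in> \<U> \<Longrightarrow> restrict p W \<in> D n W) \<Longrightarrow> p \<in> D n U"
    using D[THEN conjunct2, THEN conjunct2, THEN conjunct2, rule_format, of n U \<U> p] assms(2)
    by blast
qed

text \<open>The gluing axiom in pointwise form. Taking as cover all open subsets on which
  \<open>p\<close> restricts to a plot avoids choosing one neighbourhood for each point.\<close>

lemma diffeology_local:
  assumes D: "diffeology X D" and U: "open_in_Rn n U" and p: "p \<in> U \<rightarrow>\<^sub>E X"
    and loc: "\<And>u. u \<in> U \<Longrightarrow>
      \<exists>W. open_in_Rn n W \<and> u \<in> W \<and> W \<subseteq> U \<and> restrict p W \<in> D n W"
  shows "p \<in> D n U"
proof (rule diffeology_glue[OF D U p, of "{W. open_in_Rn n W \<and> W \<subseteq> U \<and> restrict p W \<in> D n W}"])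
  show "\<Union>{W. open_in_Rn n W \<and> W \<subseteq> U \<and> restrict p W \<in> D n W} = U"
    using loc by blast
qed auto

text \<open>This is the initial diffeology along \<open>f\<close>: each axiom for \<open>D\<close>
  is the axiom for \<open>E\<close> after composition with \<open>f\<close>. It is applied to
  evaluation and to the inverse of the bijection onto the quotient.\<close>

lemma diffeology_pullback:
  assumes E: "diffeology Y E" and f: "f \<in> X \<rightarrow> Y"
    and D: "\<And>n U. open_in_Rn n U \<Longrightarrow> D n U = {p \<in> U \<rightarrow>\<^sub>E X. compose U f p \<in> E n U}"
  shows "diffeology X D"
  unfolding diffeology_def
proof (intro conjI allI impI)
  fix n U assume U: "open_in_Rn n U"
  then show "D n U \<subseteq> U \<rightarrow>\<^sub>E X" using D by auto
  fix x assume x: "x \<in> X"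
  have "compose U f (\<lambda>u\<in>U. x) = (\<lambda>u\<in>U. f x)" by (auto simp: compose_def)
  with x U f show "(\<lambda>u\<in>U. x) \<in> D n U"
    by (auto simp: D intro: diffeology_const[OF E U])
next
  fix n U m V p h
  assume U: "open_in_Rn n U" and V: "open_in_Rn m V" and p: "p \<in> D n U"
    and h: "smooth_between m V n U h"
  have hVU: "h \<in> V \<rightarrow> U" using h by (simp add: smooth_between_def)
  have "compose V f (compose V p h) = compose V (compose U f p) h"
    using hVU by (rule compose_assoc)
  moreover have "compose V (compose U f p) h \<in> E m V"
    using p U V h by (auto simp: D intro: diffeology_compose[OF E U])
  moreover have "compose V p h \<in> V \<rightarrow>\<^sub>E X"
    using p hVU U by (auto simp: D compose_def)
  ultimately show "compose V p h \<in> D m V" using V by (simp add: D)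
next
  fix n U \<U> p
  assume U: "open_in_Rn n U" and \<U>: "\<forall>W\<in>\<U>. open_in_Rn n W" "\<Union>\<U> = U"
    and p: "p \<in> U \<rightarrow>\<^sub>E X" and loc: "\<forall>W\<in>\<U>. restrict p W \<in> D n W"
  have "compose U f p \<in> E n U"
  proof (rule diffeology_glue[OF E U, of _ \<U>])
    fix W assume W: "W \<in> \<U>"
    then have "restrict (compose U f p) W = compose W f (restrict p W)"
      using \<U> by (auto simp: compose_def fun_eq_iff)
    with W loc \<U> show "restrict (compose U f p) W \<in> E n W" by (simp add: D)
  qed (use p f \<U> in \<open>auto simp: compose_def\<close>)
  with p U show "p \<in> D n U" by (simp add: D)
qed

lemma generated_plots_generator:
  assumes X: "p \<in> U \<rightarrow>\<^sub>E X" and "open_in_Rn n U" "p \<in> G n U"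
  shows "p \<in> generated_plots X G n U"
  using assms unfolding generated_plots_def by blast

text \<open>The intersection of all diffeologies containing \<open>G\<close> is closed under pullback along smooth
  maps because each of them is.\<close>

lemma generated_plots_compose:
  assumes p: "p \<in> generated_plots X G n U" and U: "open_in_Rn n U" and V: "open_in_Rn m V"
    and h: "smooth_between m V n U h"
  shows "compose V p h \<in> generated_plots X G m V"
proof -
  have "compose V p h \<in> V \<rightarrow>\<^sub>E X"
    using p h by (auto simp: generated_plots_def smooth_between_def compose_def)
  then show ?thesis
    using p diffeology_compose[OF _ U _ V h] unfolding generated_plots_def by blast
qed

text \<open>Minimality of the generated diffeology, in the form of an induction rule.\<close>

lemma generated_plots_induct:
  assumes "p \<in> generated_plots X G n U" "diffeology X D"
    and "\<And>m W. open_in_Rn m W \<Longrightarrow> G m W \<subseteq> D m W"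
  shows "p \<in> D n U"
  using assms unfolding generated_plots_def by blast


section \<open>Diffeological vector spaces\<close>

lemma real_ring_simps [simp]:
  "carrier real_ring = UNIV" "r \<oplus>\<^bsub>real_ring\<^esub> s = r + s" "r \<otimes>\<^bsub>real_ring\<^esub> s = r * s"
  "\<one>\<^bsub>real_ring\<^esub> = 1" "\<zero>\<^bsub>real_ring\<^esub> = 0"
  by (simp_all add: real_ring_def)

locale dvs = module real_ring V for V :: "'a dvs" (structure) +
  assumes dvs: "diffeological_vector_space V"
begin

lemma diffeology_plots: "diffeology (carrier V) (plots V)"
  using dvs by (simp add: diffeological_vector_space_def)

lemmas smult_zero_one [simp] = smult_l_null[unfolded real_ring_simps] smult_one[unfolded real_ring_simps]

text \<open>The pair of \<open>p\<close> and \<open>q\<close> is a plot of the product, and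
  smoothness of addition sends it to the pointwise sum.\<close>

lemma plots_add:
  assumes U: "open_in_Rn n U" and p: "p \<in> plots V n U" and q: "q \<in> plots V n U"
  shows "(\<lambda>u\<in>U. p u \<oplus> q u) \<in> plots V n U"
proof -
  have pq: "p \<in> U \<rightarrow>\<^sub>E carrier V" "q \<in> U \<rightarrow>\<^sub>E carrier V"
    using diffeology_plot_funcset[OF diffeology_plots U] p q by auto
  let ?r = "\<lambda>u\<in>U. (p u, q u)"
  \<comment> \<open>Equality holds off \<open>U\<close> too, since plots and composites are both
    \<open>undefined\<close> there.\<close>
  have "compose U fst ?r = p" "compose U snd ?r = q"
    using pq by (auto simp: compose_def fun_eq_iff PiE_def extensional_def)
  with p q pq have "?r \<in> prod_plots (carrier V) (plots V) (carrier V) (plots V) n U"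
    by (auto simp: prod_plots_def)
  with dvs U have "compose U (\<lambda>(x, y). x \<oplus> y) ?r \<in> plots V n U"
    unfolding diffeological_vector_space_def smooth_map_def by blast
  also have "compose U (\<lambda>(x, y). x \<oplus> y) ?r = (\<lambda>u\<in>U. p u \<oplus> q u)"
    by (auto simp: compose_def)
  finally show ?thesis .
qed

lemma plots_smult:
  assumes U: "open_in_Rn n U" and r: "r \<in> std_real_plots n U" and p: "p \<in> plots V n U"
  shows "(\<lambda>u\<in>U. r u \<odot> p u) \<in> plots V n U"
proof -
  have pr: "p \<in> U \<rightarrow>\<^sub>E carrier V" "r \<in> U \<rightarrow>\<^sub>E UNIV"
    using diffeology_plot_funcset[OF diffeology_plots U] p r by (auto simp: std_real_plots_def)
  let ?r = "\<lambda>u\<in>U. (r u, p u)"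
  have "compose U fst ?r = r" "compose U snd ?r = p"
    using pr by (auto simp: compose_def fun_eq_iff PiE_def extensional_def)
  with p r pr have "?r \<in> prod_plots UNIV std_real_plots (carrier V) (plots V) n U"
    by (auto simp: prod_plots_def)
  with dvs U have "compose U (\<lambda>(r, x). r \<odot> x) ?r \<in> plots V n U"
    unfolding diffeological_vector_space_def smooth_map_def by blast
  also have "compose U (\<lambda>(r, x). r \<odot> x) ?r = (\<lambda>u\<in>U. r u \<odot> p u)"
    by (auto simp: compose_def)
  finally show ?thesis .
qed

lemma plots_finsum:
  assumes U: "open_in_Rn n U" and p: "\<And>i. i < k \<Longrightarrow> p i \<in> plots V n U"
  shows "(\<lambda>u\<in>U. \<Oplus>i\<in>{..<(k::nat)}. p i u) \<in> plots V n U"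
  using p
proof (induction k)
  case 0
  then show ?case using diffeology_const[OF diffeology_plots U M.zero_closed] by (simp add: restrict_def)
next
  case (Suc k)
  have cl: "p i u \<in> carrier V" if "i < Suc k" "u \<in> U" for i u
    using diffeology_plot_funcset[OF diffeology_plots U Suc.prems] that by auto
  have "(\<lambda>u\<in>U. \<Oplus>i\<in>{..<Suc k}. p i u) = (\<lambda>u\<in>U. p k u \<oplus> (\<lambda>u\<in>U. \<Oplus>i\<in>{..<k}. p i u) u)"
    by (auto simp: fun_eq_iff lessThan_Suc cl Pi_def)
  also have "\<dots> \<in> plots V n U"
    using Suc by (intro plots_add[OF U]) auto
  finally show ?case .
qed

end

lemma dvsI:
  assumes "diffeological_vector_space V"
  shows "dvs V"
  using assms by (simp add: dvs_def dvs_axioms_def diffeological_vector_space_def)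

section \<open>Transport of structure along a bijection\<close>

text \<open>Every element of \<open>carrier N\<close> is an image under \<open>f\<close>, so reading
  the compatibility equations from right to left turns each axiom for \<open>N\<close> into the
  image of an axiom for \<open>M\<close>.\<close>

lemma module_transport:
  fixes M :: "('r, 'a, 'c) module_scheme" and N :: "('r, 'b, 'd) module_scheme"
  assumes M: "module R M" and f: "bij_betw f (carrier M) (carrier N)"
    and add: "\<And>x y. x \<in> carrier M \<Longrightarrow> y \<in> carrier M \<Longrightarrow> f (x \<oplus>\<^bsub>M\<^esub> y) = f x \<oplus>\<^bsub>N\<^esub> f y"
    and smult: "\<And>r x. r \<in> carrier R \<Longrightarrow> x \<in> carrier M \<Longrightarrow> f (r \<odot>\<^bsub>M\<^esub> x) = r \<odot>\<^bsub>N\<^esub> f x"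
    and zero: "f \<zero>\<^bsub>M\<^esub> = \<zero>\<^bsub>N\<^esub>"
  shows "module R N"
proof -
  interpret M: module R M by fact
  have carrier: "carrier N = f ` carrier M" using f by (simp add: bij_betw_def)
  have "abelian_group N"
  proof (rule abelian_groupI)
    fix x assume "x \<in> carrier N"
    then obtain y where y: "y \<in> carrier M" "x = f y" by (auto simp: carrier)
    have "f (\<ominus>\<^bsub>M\<^esub> y) \<oplus>\<^bsub>N\<^esub> x = \<zero>\<^bsub>N\<^esub>"
      using y by (simp add: add[symmetric] M.l_neg zero)
    with y show "\<exists>y\<in>carrier N. y \<oplus>\<^bsub>N\<^esub> x = \<zero>\<^bsub>N\<^esub>" by (auto simp: carrier)
  qed (auto simp: carrier add[symmetric] zero[symmetric] M.a_ac)
  then show ?thesis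
    by (intro moduleI M.R.is_cring)
      (auto simp: carrier add[symmetric] smult[symmetric] M.smult_l_distr M.smult_r_distr
        M.smult_assoc1)
qed

text \<open>The operations and plots of \<open>W\<close> are those of \<open>V\<close> carried over
  by \<open>f\<close>, so \<open>W\<close> inherits the axioms of a diffeological vector space
  instead of having them as hypotheses. For the quotient this replaces a direct verification on
  cosets.\<close>

lemma dvect_isomorphicI:
  fixes V :: "'a dvs" and W :: "'b dvs"
  assumes V: "diffeological_vector_space V" and f: "bij_betw f (carrier V) (carrier W)"
    and add: "\<And>x y. x \<in> carrier V \<Longrightarrow> y \<in> carrier V \<Longrightarrow> f (x \<oplus>\<^bsub>V\<^esub> y) = f x \<oplus>\<^bsub>W\<^esub> f y"
    and smult: "\<And>r x. x \<in> carrier V \<Longrightarrow> f (r \<odot>\<^bsub>V\<^esub> x) = r \<odot>\<^bsub>W\<^esub> f x"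
    and zero: "f \<zero>\<^bsub>V\<^esub> = \<zero>\<^bsub>W\<^esub>"
    and plots: "\<And>n U. open_in_Rn n U \<Longrightarrow>
      plots W n U = {q \<in> U \<rightarrow>\<^sub>E carrier W. compose U (inv_into (carrier V) f) q \<in> plots V n U}"
  shows "dvect_isomorphic V W"
proof -
  interpret dvs V using V by (rule dvsI)
  define g where "g = inv_into (carrier V) f"
  note plots = plots[folded g_def]
  have f_in: "f x \<in> carrier W" if "x \<in> carrier V" for x
    using f that by (auto simp: bij_betw_def)
  have g_in: "g y \<in> carrier V" if "y \<in> carrier W" for y
    using f that bij_betw_inv_into[OF f] by (auto simp: g_def bij_betw_def)
  have gf [simp]: "g (f x) = x" if "x \<in> carrier V" for x
    using f that by (simp add: g_def bij_betw_inv_into_left)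
  have fg [simp]: "f (g y) = y" if "y \<in> carrier W" for y
    using f that by (simp add: g_def bij_betw_inv_into_right)
  have mod: "module real_ring W"
    by (rule module_transport[OF _ f]) (use add smult zero module_axioms in auto)
  interpret W: module real_ring W by (rule mod)
  \<comment> \<open>Apply \<open>g\<close> to
    \<open>f (g x \<oplus> g y) = x \<oplus> y\<close>.\<close>
  have g_add: "g (x \<oplus>\<^bsub>W\<^esub> y) = g x \<oplus>\<^bsub>V\<^esub> g y" if "x \<in> carrier W" "y \<in> carrier W" for x y
    using that g_in add[of "g x" "g y"] gf[of "g x \<oplus>\<^bsub>V\<^esub> g y"] by simp
  have g_smult: "g (r \<odot>\<^bsub>W\<^esub> x) = r \<odot>\<^bsub>V\<^esub> g x" if "x \<in> carrier W" for x r
    using that g_in smult[of "g x" r] gf[of "r \<odot>\<^bsub>V\<^esub> g x"] by simp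
  have diff: "diffeology (carrier W) (plots W)"
    by (rule diffeology_pullback[OF diffeology_plots _ plots]) (auto simp: g_in)
  have smooth_add: "smooth_map (carrier W \<times> carrier W)
      (prod_plots (carrier W) (plots W) (carrier W) (plots W)) (carrier W) (plots W)
      (\<lambda>(x, y). x \<oplus>\<^bsub>W\<^esub> y)"
    unfolding smooth_map_def
  proof (intro conjI allI impI)
    fix n U p assume U: "open_in_Rn n U"
      and p: "p \<in> prod_plots (carrier W) (plots W) (carrier W) (plots W) n U"
    have pW: "fst (p u) \<in> carrier W" "snd (p u) \<in> carrier W" if "u \<in> U" for u
      using PiE_mem[of p U "\<lambda>_. carrier W \<times> carrier W" u] p that
      by (simp_all add: prod_plots_def mem_Times_iff)
    \<comment> \<open>Both components are moved to \<open>V\<close> and added there. By additivity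
      of \<open>g\<close>, the result is the sum in \<open>W\<close> moved to
      \<open>V\<close>.\<close>
    have "compose U g (compose U fst p) \<in> plots V n U"
        "compose U g (compose U snd p) \<in> plots V n U"
      using p U by (auto simp: prod_plots_def plots)
    from plots_add[OF U this] have "(\<lambda>u\<in>U. compose U g (compose U fst p) u \<oplus>\<^bsub>V\<^esub> compose U g (compose U snd p) u)
      \<in> plots V n U" .
    also have "(\<lambda>u\<in>U. compose U g (compose U fst p) u \<oplus>\<^bsub>V\<^esub> compose U g (compose U snd p) u)
      = compose U g (compose U (\<lambda>(x, y). x \<oplus>\<^bsub>W\<^esub> y) p)"
      by (auto simp: compose_def fun_eq_iff case_prod_unfold g_add pW)
    finally have "compose U g (compose U (\<lambda>(x, y). x \<oplus>\<^bsub>W\<^esub> y) p) \<in> plots V n U" .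
    moreover have "compose U (\<lambda>(x, y). x \<oplus>\<^bsub>W\<^esub> y) p \<in> U \<rightarrow>\<^sub>E carrier W"
      by (auto simp: compose_def case_prod_unfold pW)
    ultimately show "compose U (\<lambda>(x, y). x \<oplus>\<^bsub>W\<^esub> y) p \<in> plots W n U"
      by (simp add: plots[OF U])
  qed auto
  have smooth_smult: "smooth_map (UNIV \<times> carrier W)
      (prod_plots UNIV std_real_plots (carrier W) (plots W)) (carrier W) (plots W)
      (\<lambda>(r, x). r \<odot>\<^bsub>W\<^esub> x)"
    unfolding smooth_map_def
  proof (intro conjI allI impI)
    fix n U p assume U: "open_in_Rn n U"
      and p: "p \<in> prod_plots UNIV std_real_plots (carrier W) (plots W) n U"
    have pW: "snd (p u) \<in> carrier W" if "u \<in> U" for u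
      using PiE_mem[of p U "\<lambda>_. UNIV \<times> carrier W" u] p that
      by (simp_all add: prod_plots_def mem_Times_iff)
    have "compose U fst p \<in> std_real_plots n U" "compose U g (compose U snd p) \<in> plots V n U"
      using p U by (auto simp: prod_plots_def plots)
    from plots_smult[OF U this] have "(\<lambda>u\<in>U. compose U fst p u \<odot>\<^bsub>V\<^esub> compose U g (compose U snd p) u) \<in> plots V n U" .
    also have "(\<lambda>u\<in>U. compose U fst p u \<odot>\<^bsub>V\<^esub> compose U g (compose U snd p) u)
      = compose U g (compose U (\<lambda>(r, x). r \<odot>\<^bsub>W\<^esub> x) p)"
      by (auto simp: compose_def fun_eq_iff case_prod_unfold g_smult pW)
    finally have "compose U g (compose U (\<lambda>(r, x). r \<odot>\<^bsub>W\<^esub> x) p) \<in> plots V n U" .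
    moreover have "compose U (\<lambda>(r, x). r \<odot>\<^bsub>W\<^esub> x) p \<in> U \<rightarrow>\<^sub>E carrier W"
      by (auto simp: compose_def case_prod_unfold pW)
    ultimately show "compose U (\<lambda>(r, x). r \<odot>\<^bsub>W\<^esub> x) p \<in> plots W n U"
      by (simp add: plots[OF U])
  qed auto
  have "diffeological_vector_space W"
    using mod diff smooth_add smooth_smult by (simp add: diffeological_vector_space_def)
  moreover have "smooth_map (carrier V) (plots V) (carrier W) (plots W) f"
    unfolding smooth_map_def
  proof (intro conjI allI impI)
    fix n U p assume U: "open_in_Rn n U" and p: "p \<in> plots V n U"
    have pU: "p \<in> U \<rightarrow>\<^sub>E carrier V" by (rule diffeology_plot_funcset[OF diffeology_plots U p])
    then have "compose U g (compose U f p) = p"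
      by (auto simp: compose_def fun_eq_iff PiE_def extensional_def Pi_def)
    with p pU show "compose U f p \<in> plots W n U"
      by (auto simp: plots[OF U] compose_def intro!: f_in)
  qed (simp add: f_in)
  moreover have "smooth_map (carrier W) (plots W) (carrier V) (plots V) g"
    by (auto simp: smooth_map_def plots g_in)
  ultimately show ?thesis
    unfolding dvect_isomorphic_def dvect_hom_def hom_def
    using V f add smult by (intro conjI bexI[of _ f]) (auto simp: g_def f_in)
qed


section \<open>The free diffeological vector space\<close>

lemma lookup_map_mult [simp]:
  "Poly_Mapping.lookup (Poly_Mapping.map ((*) r) c) x = (r :: real) * Poly_Mapping.lookup c x"
  by (simp add: Poly_Mapping.map.rep_eq when_def)

lemma keys_map_mult: "Poly_Mapping.keys (Poly_Mapping.map ((*) (r::real)) c) \<subseteq> Poly_Mapping.keys c"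
  by (auto simp: in_keys_iff)

lemma free_dvs_simps [simp]:
  "carrier (free_dvs X D) = free_carrier X" "\<zero>\<^bsub>free_dvs X D\<^esub> = 0"
  "c \<oplus>\<^bsub>free_dvs X D\<^esub> d = c + d" "r \<odot>\<^bsub>free_dvs X D\<^esub> c = Poly_Mapping.map ((*) r) c"
  "plots (free_dvs X D) = generated_plots (free_carrier X) (free_generators D)"
  by (simp_all add: free_dvs_def)

lemma free_carrier_closed [simp, intro]:
  "0 \<in> free_carrier X"
  "c \<in> free_carrier X \<Longrightarrow> d \<in> free_carrier X \<Longrightarrow> c + d \<in> free_carrier X"
  "c \<in> free_carrier X \<Longrightarrow> d \<in> free_carrier X \<Longrightarrow> c - d \<in> free_carrier X"
  "c \<in> free_carrier X \<Longrightarrow> - c \<in> free_carrier X"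
  "c \<in> free_carrier X \<Longrightarrow> Poly_Mapping.map ((*) r) c \<in> free_carrier X"
  "x \<in> X \<Longrightarrow> Poly_Mapping.single x r \<in> free_carrier X"
  using keys_add[of c d] keys_diff[of c d] keys_map_mult[of r c]
  by (auto simp: free_carrier_def in_keys_iff)

lemma free_carrier_sum:
  "(\<And>i. i \<in> I \<Longrightarrow> c i \<in> free_carrier X) \<Longrightarrow> sum c I \<in> free_carrier X"
  by (induction I rule: infinite_finite_induct) auto

text \<open>The premise will be supplied by the module structure of a given \<open>V\<close>, which
  already contains that \<open>real_ring\<close> is a commutative ring.\<close>

lemma module_free_dvs:
  assumes "cring real_ring"
  shows "module real_ring (free_dvs X D)"
proof (rule moduleI[OF assms])
  show "abelian_group (free_dvs X D)"
  proof (rule abelian_groupI)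
    fix c assume "c \<in> carrier (free_dvs X D)"
    then show "\<exists>d\<in>carrier (free_dvs X D). d \<oplus>\<^bsub>free_dvs X D\<^esub> c = \<zero>\<^bsub>free_dvs X D\<^esub>"
      by (intro bexI[of _ "- c"]) auto
  qed (auto simp: add_ac)
qed (auto intro!: poly_mapping_eqI simp: lookup_add algebra_simps)

text \<open>The plot is the one-term generator pulled back along \<open>u \<mapsto> (1, u)\<close>.\<close>

lemma free_dvs_single_plot:
  assumes D: "diffeology X D" and U: "open_in_Rn n U" and p: "p \<in> D n U"
  shows "(\<lambda>u\<in>U. Poly_Mapping.single (p u) 1) \<in> plots (free_dvs X D) n U"
proof -
  define d where "d = (\<lambda>i::nat. n)"
  define W where "W = generator_domain 1 d (\<lambda>_. U)"
  define q where "q = (\<lambda>w\<in>W. Poly_Mapping.single (p (point_coord d 0 w)) (scalar_coord d 0 w))"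
  define h where "h = (\<lambda>(u :: nat \<Rightarrow> real) i. if i = 0 then 1 else u (i - 1))"
  have W: "open_in_Rn (offset d 1) W"
    unfolding W_def by (rule openin_generator_domain_one) (simp add: d_def U)
  have pU: "p \<in> U \<rightarrow>\<^sub>E X" by (rule diffeology_plot_funcset[OF D U p])
  have "q \<in> free_generators D (offset d 1) W"
    unfolding free_generators_def q_def W_def
    using U p by (auto intro!: exI[of _ 1] exI[of _ d] exI[of _ "\<lambda>_. U"] exI[of _ "\<lambda>_. p"]
        simp: d_def)
  moreover have "q \<in> W \<rightarrow>\<^sub>E free_carrier X"
    using pU by (auto simp: q_def W_def generator_domain_def)
  ultimately have q: "q \<in> plots (free_dvs X D) (offset d 1) W"
    using W by (simp add: generated_plots_generator)
  \<comment> \<open>Points of \<open>U\<close> vanish from index \<open>n\<close> on, exactly where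
    \<open>point_coord\<close> fills in 0; hence the projection recovers \<open>u\<close> from
    \<open>h u\<close>.\<close>
  have U0: "u i = 0" if "u \<in> U" "n \<le> i" for u i
    using openin_subset[OF U] that by (auto simp: topspace_Euclidean_space)
  have pt: "point_coord d 0 (h u) = u" if "u \<in> U" for u
    using U0[OF that] by (auto simp: point_coord_def d_def offset_def h_def fun_eq_iff)
  have h0: "h u 0 = 1" for u by (simp add: h_def)
  have hUW: "h \<in> U \<rightarrow> W"
    using pt U0
    by (auto simp: W_def generator_domain_def topspace_Euclidean_space offset_def d_def h_def)
  have "smooth_between n U (offset d 1) W h"
    by (rule smooth_between_const_or_component[OF hUW]) (auto simp: h_def)
  from generated_plots_compose[OF q[simplified] W[simplified] U this[simplified]]
  have "compose U q h \<in> plots (free_dvs X D) n U" by simp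
  also have "compose U q h = (\<lambda>u\<in>U. Poly_Mapping.single (p u) 1)"
    using hUW h0 by (auto simp: compose_def q_def pt scalar_coord_def offset_def fun_eq_iff Pi_def)
  finally show ?thesis .
qed

section \<open>The evaluation map\<close>

context dvs
begin

text \<open>The linear extension of the identity of \<open>V\<close>, that is, the counit of the
  free-forgetful adjunction at \<open>V\<close>.\<close>

definition eval :: "('a \<Rightarrow>\<^sub>0 real) \<Rightarrow> 'a" where
  "eval c = (\<Oplus>x\<in>Poly_Mapping.keys c. Poly_Mapping.lookup c x \<odot> x)"

text \<open>Terms outside the support have coefficient 0. Summing over a common finite set is what
  makes linearity provable termwise, since supports can shrink under addition and under
  multiplication by 0.\<close>

lemma eval_superset:
  assumes "finite A" "Poly_Mapping.keys c \<subseteq> A" "A \<subseteq> carrier V"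
  shows "eval c = (\<Oplus>x\<in>A. Poly_Mapping.lookup c x \<odot> x)"
  unfolding eval_def
  by (rule add.finprod_mono_neutral_cong_left) (use assms in \<open>auto simp: in_keys_iff\<close>)

lemma eval_closed [simp]: "c \<in> free_carrier (carrier V) \<Longrightarrow> eval c \<in> carrier V"
  unfolding eval_def free_carrier_def by (rule finsum_closed) auto

lemma eval_add:
  assumes "c \<in> free_carrier (carrier V)" "d \<in> free_carrier (carrier V)"
  shows "eval (c + d) = eval c \<oplus> eval d"
proof -
  let ?A = "Poly_Mapping.keys c \<union> Poly_Mapping.keys d"
  have A: "finite ?A" "?A \<subseteq> carrier V" using assms by (auto simp: free_carrier_def)
  have "eval (c + d) = (\<Oplus>x\<in>?A. Poly_Mapping.lookup (c + d) x \<odot> x)"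
    using A by (intro eval_superset keys_add) auto
  also have "\<dots> = (\<Oplus>x\<in>?A. Poly_Mapping.lookup c x \<odot> x \<oplus> Poly_Mapping.lookup d x \<odot> x)"
    using A by (intro finsum_cong')
      (auto simp: lookup_add smult_l_distr[simplified] subset_iff)
  also have "\<dots> = (\<Oplus>x\<in>?A. Poly_Mapping.lookup c x \<odot> x) \<oplus> (\<Oplus>x\<in>?A. Poly_Mapping.lookup d x \<odot> x)"
    using A by (intro finsum_addf) auto
  also have "\<dots> = eval c \<oplus> eval d"
    using A by (simp add: eval_superset[of ?A])
  finally show ?thesis .
qed

lemma eval_smult:
  assumes "c \<in> free_carrier (carrier V)"
  shows "eval (Poly_Mapping.map ((*) r) c) = r \<odot> eval c"
proof -
  let ?A = "Poly_Mapping.keys c"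
  have A: "finite ?A" "?A \<subseteq> carrier V" using assms by (auto simp: free_carrier_def)
  have "eval (Poly_Mapping.map ((*) r) c) = (\<Oplus>x\<in>?A. (r * Poly_Mapping.lookup c x) \<odot> x)"
    using A keys_map_mult[of r c] by (subst eval_superset[of ?A]) auto
  also have "\<dots> = (\<Oplus>x\<in>?A. r \<odot> (Poly_Mapping.lookup c x \<odot> x))"
    using A by (intro finsum_cong') (auto simp: smult_assoc1[simplified] subset_iff)
  also have "\<dots> = r \<odot> eval c"
    unfolding eval_def using A by (intro finsum_smult_ldistr[symmetric]) auto
  finally show ?thesis .
qed

lemma eval_zero [simp]: "eval 0 = \<zero>"
  by (simp add: eval_def)

lemma eval_single [simp]: "x \<in> carrier V \<Longrightarrow> eval (Poly_Mapping.single x r) = r \<odot> x"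
  by (subst eval_superset[of "{x}"]) (auto simp: in_keys_iff lookup_single when_def split: if_splits)

lemma eval_sum:
  assumes "\<And>i. i < k \<Longrightarrow> c i \<in> free_carrier (carrier V)"
  shows "eval (\<Sum>i<(k::nat). c i) = (\<Oplus>i\<in>{..<k}. eval (c i))"
  using assms
proof (induction k)
  case (Suc k)
  moreover have "sum c {..<k} \<in> free_carrier (carrier V)"
    using Suc.prems by (intro free_carrier_sum) simp
  ultimately show ?case
    by (simp add: lessThan_Suc eval_add Pi_def)
qed simp

text \<open>By minimality it suffices that the pullback diffeology along \<open>eval\<close>
  contains the generators. Evaluating a generator replaces formal sums and multiples by those of
  \<open>V\<close>, which preserve plots.\<close>

lemma eval_plot:
  assumes U: "open_in_Rn n U" and p: "p \<in> plots (free_dvs (carrier V) (plots V)) n U"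
  shows "compose U eval p \<in> plots V n U"
proof -
  let ?F = "free_carrier (carrier V)"
  let ?D = "\<lambda>n U. {p \<in> U \<rightarrow>\<^sub>E ?F. compose U eval p \<in> plots V n U}"
  have "p \<in> ?D n U"
  proof (rule generated_plots_induct[OF p[simplified]])
    show "diffeology ?F ?D"
      by (rule diffeology_pullback[where f = eval, OF diffeology_plots]) auto
    fix N W assume W: "open_in_Rn N W"
    show "free_generators (plots V) N W \<subseteq> ?D N W"
    proof
      fix q assume "q \<in> free_generators (plots V) N W"
      then obtain k d U p where
        q: "q = (\<lambda>w\<in>W. \<Sum>i<k. Poly_Mapping.single (p i (point_coord d i w)) (scalar_coord d i w))"
        and U: "\<And>i. i < k \<Longrightarrow> open_in_Rn (d i) (U i)"
        and p: "\<And>i. i < k \<Longrightarrow> p i \<in> plots V (d i) (U i)"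
        and Wdef: "W = generator_domain k d U"
        unfolding free_generators_def by blast
      have pt: "point_coord d i w \<in> U i" if "i < k" "w \<in> W" for i w
        using that by (simp add: Wdef generator_domain_def)
      have p_in: "p i (point_coord d i w) \<in> carrier V" if "i < k" "w \<in> W" for i w
        using diffeology_plot_funcset[OF diffeology_plots U[OF that(1)] p[OF that(1)]] pt[OF that]
        by auto
      \<comment> \<open>All factors must be plots on the same domain, so each \<open>p i\<close> is
        pulled back to \<open>W\<close> along a projection.\<close>
      have "compose W (p i) (point_coord d i) \<in> plots V N W" if "i < k" for i
        by (rule diffeology_compose[OF diffeology_plots U[OF that] p[OF that] W
            smooth_between_point_coord[OF pt[OF that]]])
      then have "(\<lambda>w\<in>W. (\<lambda>w\<in>W. w (offset d i)) w \<odot> compose W (p i) (point_coord d i) w)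
          \<in> plots V N W" if "i < k" for i
        using that by (intro plots_smult[OF W] component_std_real_plot[OF W])
      from plots_finsum[OF W this]
      have "(\<lambda>w\<in>W. \<Oplus>i\<in>{..<k}.
          (\<lambda>w\<in>W. (\<lambda>w\<in>W. w (offset d i)) w \<odot> compose W (p i) (point_coord d i) w) w)
          \<in> plots V N W" .
      also have "(\<lambda>w\<in>W. \<Oplus>i\<in>{..<k}.
          (\<lambda>w\<in>W. (\<lambda>w\<in>W. w (offset d i)) w \<odot> compose W (p i) (point_coord d i) w) w)
        = compose W eval q"
        unfolding compose_def
      proof (rule restrict_ext)
        fix w assume w: "w \<in> W"
        have "eval (q w) = (\<Oplus>i\<in>{..<k}.
            eval (Poly_Mapping.single (p i (point_coord d i w)) (scalar_coord d i w)))"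
          using w p_in by (simp add: q eval_sum free_carrier_closed)
        also have "\<dots> = (\<Oplus>i\<in>{..<k}. w (offset d i) \<odot> p i (point_coord d i w))"
          using w p_in by (intro finsum_cong') (auto simp: scalar_coord_def)
        finally show "(\<Oplus>i\<in>{..<k}. (\<lambda>w\<in>W. (\<lambda>w\<in>W. w (offset d i)) w \<odot>
            (\<lambda>w\<in>W. p i (point_coord d i w)) w) w) = eval (q w)"
          using w by simp
      qed
      finally show "q \<in> ?D N W"
        using p_in by (auto simp: q intro!: free_carrier_sum)
    qed
  qed
  then show ?thesis by simp
qed

section \<open>Fibres of evaluation as cosets of its kernel \<open>fibre \<zero>\<close>\<close>

definition fibre :: "'a \<Rightarrow> ('a \<Rightarrow>\<^sub>0 real) set" where
  "fibre v = {c \<in> free_carrier (carrier V). eval c = v}"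

abbreviation free :: "('a \<Rightarrow>\<^sub>0 real) dvs" where
  "free \<equiv> free_dvs (carrier V) (plots V)"

lemma single_in_fibre: "v \<in> carrier V \<Longrightarrow> Poly_Mapping.single v 1 \<in> fibre v"
  using smult_one[of v] by (simp add: fibre_def free_carrier_closed)

lemma submodule_fibre_zero: "submodule (fibre \<zero>) real_ring free"
proof -
  interpret F: module real_ring free by (rule module_free_dvs[OF R.is_cring])
  have smult: "r \<odot>\<^bsub>free\<^esub> c \<in> fibre \<zero>" if "c \<in> fibre \<zero>" for r c
    using that by (auto simp: fibre_def eval_smult)
  show ?thesis
  proof (rule F.submoduleI)
    fix c assume c: "c \<in> fibre \<zero>"
    \<comment> \<open>Negation is a scalar multiple, so closure under scalars covers it; the scalar
      can stay in the form \<open>\<ominus> 1\<close> because \<open>smult\<close> holds for every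
      scalar.\<close>
    then have "\<ominus>\<^bsub>free\<^esub> c = (\<ominus>\<^bsub>real_ring\<^esub> 1) \<odot>\<^bsub>free\<^esub> c"
      using F.smult_l_minus[of 1 c] F.smult_one[of c] by (simp add: fibre_def)
    with smult[OF c] show "\<ominus>\<^bsub>free\<^esub> c \<in> fibre \<zero>" by simp
  qed (use smult in \<open>auto simp: fibre_def eval_add\<close>)
qed

text \<open>By additivity, \<open>d\<close> and \<open>c\<close> have the same value iff
  \<open>d - c\<close> lies in the kernel.\<close>

lemma coset_eq_fibre:
  assumes c: "c \<in> free_carrier (carrier V)"
  shows "fibre \<zero> +>\<^bsub>free\<^esub> c = fibre (eval c)"
proof (intro equalityI subsetI)
  fix d assume "d \<in> fibre \<zero> +>\<^bsub>free\<^esub> c"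
  with c show "d \<in> fibre (eval c)"
    by (auto simp: a_r_coset_def' fibre_def eval_add)
next
  fix d assume d: "d \<in> fibre (eval c)"
  with c have dc: "d - c \<in> free_carrier (carrier V)" by (auto simp: fibre_def)
  \<comment> \<open>The summand \<open>\<zero>\<close> is kept on the left so that cancelling
    \<open>eval c\<close> yields \<open>eval (d - c) = \<zero>\<close>; hence the removal of
    \<open>l_zero\<close> below.\<close>
  have "\<zero> \<oplus> eval c = eval (d - c) \<oplus> eval c"
    using eval_add[OF dc c] d c by (simp add: fibre_def)
  then have "d - c \<in> fibre \<zero>"
    using c dc by (simp add: fibre_def del: l_zero)
  then show "d \<in> fibre \<zero> +>\<^bsub>free\<^esub> c"
    by (force simp: a_r_coset_def')
qed

text \<open>Evaluation is onto, as \<open>[v]\<close> evaluates to \<open>v\<close>, so the cosets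
  run through the fibres over all of \<open>V\<close>.\<close>

lemma cosets_eq_fibres: "a_rcosets\<^bsub>free\<^esub> (fibre \<zero>) = fibre ` carrier V"
proof -
  have "v \<in> eval ` free_carrier (carrier V)" if "v \<in> carrier V" for v
    using that by (intro image_eqI[of _ _ "Poly_Mapping.single v 1"]) (simp_all add: free_carrier_closed)
  then have "eval ` free_carrier (carrier V) = carrier V" by auto
  moreover have "a_rcosets\<^bsub>free\<^esub> (fibre \<zero>) = (\<lambda>c. fibre (eval c)) ` free_carrier (carrier V)"
    by (simp add: A_RCOSETS_def' coset_eq_fibre UNION_singleton_eq_range)
  ultimately show ?thesis by (metis image_image)
qed

text \<open>The element \<open>[x]\<close> lies in the fibre over \<open>x\<close> and in no
  other.\<close>

lemma inj_on_fibre: "inj_on fibre (carrier V)"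
proof (rule inj_onI)
  fix x y assume "x \<in> carrier V" "fibre x = fibre y"
  with single_in_fibre[of x] have "Poly_Mapping.single x 1 \<in> fibre y" by simp
  with \<open>x \<in> carrier V\<close> show "x = y" by (simp add: fibre_def)
qed

text \<open>One inclusion is additivity of \<open>eval\<close>. For the other, \<open>c\<close> over
  \<open>x \<oplus> y\<close> splits as \<open>[x] + (c - [x])\<close>, whose second summand
  evaluates to \<open>y\<close>.\<close>

lemma fibre_add:
  assumes "x \<in> carrier V" "y \<in> carrier V"
  shows "fibre x <+>\<^bsub>free\<^esub> fibre y = fibre (x \<oplus> y)"
proof (intro equalityI subsetI)
  fix c assume c: "c \<in> fibre (x \<oplus> y)"
  let ?s = "Poly_Mapping.single x 1"
  have s: "?s \<in> fibre x" using assms(1) by (rule single_in_fibre)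
  have cs: "c - ?s \<in> free_carrier (carrier V)" using c s by (auto simp: fibre_def)
  have "eval c = eval ?s \<oplus> eval (c - ?s)"
    using eval_add[OF _ cs, of ?s] s by (simp add: fibre_def)
  then have "x \<oplus> eval (c - ?s) = x \<oplus> y"
    using c s by (simp add: fibre_def)
  then have "eval (c - ?s) = y"
    using assms cs by simp
  with cs have "c - ?s \<in> fibre y" by (simp add: fibre_def)
  moreover have "c = ?s + (c - ?s)" by simp
  ultimately show "c \<in> fibre x <+>\<^bsub>free\<^esub> fibre y"
    unfolding set_add_def set_mult_def using s by fastforce
qed (auto simp: set_add_defs fibre_def eval_add)

text \<open>The left side is the scalar multiplication of the quotient. All members of the union are
  the same coset, and the union is over a nonempty set because \<open>[x]\<close> lies in
  \<open>fibre x\<close>.\<close>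

lemma fibre_smult:
  assumes "x \<in> carrier V"
  shows "(\<Union>c\<in>fibre x. fibre \<zero> +>\<^bsub>free\<^esub> (r \<odot>\<^bsub>free\<^esub> c)) = fibre (r \<odot> x)"
proof -
  have "fibre \<zero> +>\<^bsub>free\<^esub> (r \<odot>\<^bsub>free\<^esub> c) = fibre (r \<odot> x)" if "c \<in> fibre x" for c
  proof -
    have "eval c = x" "c \<in> free_carrier (carrier V)" using that by (auto simp: fibre_def)
    then show ?thesis by (simp add: coset_eq_fibre eval_smult)
  qed
  then show ?thesis using single_in_fibre[OF assms] by auto
qed

text \<open>This identifies the quotient diffeology with that of \<open>V\<close> carried over by
  \<open>fibre\<close>, the condition on plots in \<open>dvect_isomorphicI\<close>.\<close>

lemma quotient_plots_fibre:
  assumes U: "open_in_Rn n U"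
  shows "quotient_plots free (fibre \<zero>) n U =
    {q \<in> U \<rightarrow>\<^sub>E fibre ` carrier V. compose U (inv_into (carrier V) fibre) q \<in> plots V n U}"
    (is "?L = ?R")
proof (intro equalityI subsetI)
  let ?g = "inv_into (carrier V) fibre"
  fix q assume q: "q \<in> ?L"
  then have qU: "q \<in> U \<rightarrow>\<^sub>E fibre ` carrier V"
    by (simp add: quotient_plots_def cosets_eq_fibres)
  \<comment> \<open>A local lift \<open>p\<close> of \<open>q\<close> satisfies
    \<open>?g (q v) = eval (p v)\<close>, so smoothness of \<open>eval\<close> gives plots locally,
    and these glue.\<close>
  have "compose U ?g q \<in> plots V n U"
  proof (rule diffeology_local[OF diffeology_plots U])
    show "compose U ?g q \<in> U \<rightarrow>\<^sub>E carrier V"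
      unfolding compose_def restrict_PiE_iff by (intro ballI inv_into_into PiE_mem[OF qU])
    fix u assume u: "u \<in> U"
    have "\<forall>u\<in>U. \<exists>W p. open_in_Rn n W \<and> u \<in> W \<and> W \<subseteq> U \<and>
        p \<in> plots free n W \<and> (\<forall>v\<in>W. q v = fibre \<zero> +>\<^bsub>free\<^esub> p v)"
      using q unfolding quotient_plots_def mem_Collect_eq by (rule conjunct2)
    from bspec[OF this u] obtain W p where W: "open_in_Rn n W" "u \<in> W" "W \<subseteq> U"
      and p: "p \<in> plots free n W" and qp: "\<forall>v\<in>W. q v = fibre \<zero> +>\<^bsub>free\<^esub> p v"
      by (elim exE conjE)
    have "?g (q v) = eval (p v)" if v: "v \<in> W" for v
    proof -
      have pv: "p v \<in> free_carrier (carrier V)"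
        using p v by (auto simp: generated_plots_def)
      then have "q v = fibre (eval (p v))"
        using qp v coset_eq_fibre by simp
      with pv show ?thesis by (simp add: inv_into_f_f[OF inj_on_fibre])
    qed
    then have "restrict (compose U ?g q) W = compose W eval p"
      using W(3) by (auto simp: compose_def fun_eq_iff)
    with eval_plot[OF W(1) p] have "restrict (compose U ?g q) W \<in> plots V n W"
      by (simp only:)
    with W show "\<exists>W. open_in_Rn n W \<and> u \<in> W \<and> W \<subseteq> U \<and> restrict (compose U ?g q) W \<in> plots V n W"
      by (intro exI conjI)
  qed
  with qU show "q \<in> ?R" by (intro CollectI conjI)
next
  let ?g = "inv_into (carrier V) fibre"
  fix q assume "q \<in> ?R"
  then have qU: "q \<in> U \<rightarrow>\<^sub>E fibre ` carrier V" and gq: "compose U ?g q \<in> plots V n U"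
    by (simp_all only: mem_Collect_eq)
  \<comment> \<open>A lift on all of \<open>U\<close>: the basis element of the point over which
    \<open>q u\<close> is the fibre.\<close>
  let ?p = "\<lambda>u\<in>U. Poly_Mapping.single (compose U ?g q u) 1"
  have p: "?p \<in> plots free n U"
    by (rule free_dvs_single_plot[OF diffeology_plots U gq])
  have "q v = fibre \<zero> +>\<^bsub>free\<^esub> ?p v" if v: "v \<in> U" for v
  proof -
    have qv: "q v \<in> fibre ` carrier V" using qU v by (rule PiE_mem)
    then have g: "?g (q v) \<in> carrier V" "fibre (?g (q v)) = q v"
      by (rule inv_into_into, rule f_inv_into_f)
    then show ?thesis
      using v coset_eq_fibre[of "Poly_Mapping.single (?g (q v)) 1"]
      by (simp add: compose_def free_carrier_closed)
  qed
  with p U qU show "q \<in> ?L"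
    unfolding quotient_plots_def cosets_eq_fibres
    by (intro CollectI conjI ballI exI[of _ U] exI[of _ ?p]) simp_all
qed

lemma isomorphic_quotient_free: "dvect_isomorphic V (quotient_dvs free (fibre \<zero>))"
proof (rule dvect_isomorphicI[OF dvs, of fibre])
  show "bij_betw fibre (carrier V) (carrier (quotient_dvs free (fibre \<zero>)))"
    using inj_on_fibre by (simp add: bij_betw_def quotient_dvs_def cosets_eq_fibres)
qed (simp_all add: quotient_dvs_def cosets_eq_fibres fibre_add
    fibre_smult[simplified] quotient_plots_fibre)

end

theorem corollary3p13:
  fixes V :: "'a dvs"
  assumes "diffeological_vector_space V"
  shows "\<exists>(X :: 'a set) D K. diffeology X D \<and> submodule K real_ring (free_dvs X D) \<and>
           dvect_isomorphic V (quotient_dvs (free_dvs X D) K)"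
proof -
  interpret dvs V using assms by (rule dvsI)
  show ?thesis
    using diffeology_plots submodule_fibre_zero isomorphic_quotient_free by blast
qed

end
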